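(* Let the Pick matrix $P$ of an interpolation data set be invertible, let $\varphi\in\widetilde{\mathbf{N}}_0$, let $w=\mathbf{T}_\Theta[\varphi]$, and let $x_i$ be an interpolation node with $i\in\{\ell+1,\dots,n\}$. Suppose that $\tilde e_i=0$. Then: 1. The nontangential boundary limit $w_{-1}(x_i)$ exists and $w_{-1}(x_i)=\xi_i$ if and only if $\varphi$ meets either condition $\widetilde{\mathbf C}_1$ or $\widetilde{\mathbf C}_2$ at $x_i$. 2. The nontangential boundary limit $w_{-1}(x_i)$ exists and $-\infty<-w_{-1}^{-1}(x_i)<-\xi_i^{-1}$ if and only if $\varphi$ meets condition $\widetilde{\mathbf C}_3$ at $x_i$. 3. The nontangential boundary limit $w_{-1}(x_i)$ exists and $-\xi_i^{-1}<-w_{-1}^{-1}(x_i)<\infty$ if and only if $\varphi$ meets condition $\widetilde{\mathbf C}_4$ at $x_i$. 4. The nontangential boundary limit $w_{-1}(x_i)$ exists and $w_{-1}(x_i)=0$ if and only if $\varphi$ meets either condition $\widetilde{\mathbf C}_5$ or $\widetilde{\mathbf C}_6$ at $x_i$.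
   Context: Classes. $\mathbb{C}^+$ is the open upper half plane. $\mathbf{N}_0$ is the Nevanlinna class (functions analytic on $\mathbb{C}^+$ with nonnegative imaginary part) and $\widetilde{\mathbf{N}}_0=\mathbf{N}_0\cup\{\infty\}$, where $\infty$ is the function identically $\infty$. Boundary limits. For $x\in\mathbb{R}$, $f(x)$ and $f_{-1}(x)$ denote the nontangential limits as $z\to x$ of $f(z)$ and $(z-x)f(z)$, when they exist in $\mathbb{C}\cup\{\infty\}$. If $f\equiv\infty$, then $f_{-1}(x)=\infty$. Here $f_{-1}^{-1}(x)=1/f_{-1}(x)$, with $1/\infty=0$ (while $1/0$ is not finite). Data. $x_1,\dots,x_n$ are distinct real numbers (nodes), $0\le\ell\le n$, $w_j,\gamma_j\in\mathbb{R}$ $(1\le j\le\ell)$, $\xi_k\in\mathbb{R}\setminus\{0\}$ $(\ell<k\le n)$. The Pick matrix $P=[p_{ij}]_{i,j=1}^n$ is the real symmetric matrix with: $p_{ij}=\frac{w_j-w_i}{x_j-x_i}$ for $i\ne j$ and $p_{ii}=\gamma_i$, for $i,j\le\ell$; $p_{ij}=p_{ji}=\frac{\xi_j}{x_j-x_i}$ for $i\le\ell<j$; $p_{ii}=-\xi_i$ and $p_{ij}=0$ $(i\neq j)$ for $i,j>\ell$. Also $X=\mathrm{diag}(x_1,\dots,x_n)$, $C=[w_1\ \cdots\ w_\ell\ \xi_{\ell+1}\ \cdots\ \xi_n]$, $E=[1\ \cdots\ 1\ 0\ \cdots\ 0]$ ($\ell$ ones), $J=\begin{bmatrix}0&-i\\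 i&0\end{bmatrix}$. For $P$ invertible, $\Theta(z)=[\Theta_{ij}(z)]_{i,j=1}^2=I_2-i\begin{bmatrix}C\\ E\end{bmatrix}(zI-X)^{-1}P^{-1}\begin{bmatrix}C^*&E^*\end{bmatrix}J$ and $\mathbf{T}_\Theta[\varphi]=\frac{\Theta_{11}\varphi+\Theta_{12}}{\Theta_{21}\varphi+\Theta_{22}}$, with $\mathbf{T}_\Theta[\infty]=\Theta_{11}/\Theta_{21}$ ($\mathbf{T}_\Theta[\varphi]\equiv\infty$ if the denominator vanishes identically). Let $\tilde c_i$, $\tilde e_i$ be the $i$-th entries of the row vectors $CP^{-1}$, $EP^{-1}$ (real, not both zero), and $\tilde p_{ii}$ the $i$-th diagonal entry of $P^{-1}$. Conditions on $\varphi\in\widetilde{\mathbf{N}}_0$ at $x_i$ when $\tilde e_i=0$ (exactly one holds): $\widetilde{\mathbf C}_1$: it is not the case that the limit $\varphi(x_i)$ exists and equals $\infty$. $\widetilde{\mathbf C}_2$: $\varphi(x_i)=\infty$ and $\varphi_{-1}(x_i)=0$. $\widetilde{\mathbf C}_3$: $\varphi(x_i)=\infty$ and $-\tilde p_{ii}/\tilde c_i^2<-1/\varphi_{-1}(x_i)<\infty$. $\widetilde{\mathbf C}_4$: $\varphi(x_i)=\infty$ and $0\le-1/\varphi_{-1}(x_i)<-\tilde p_{ii}/\tilde c_i^2$. $\widetilde{\mathbf C}_5$: $\varphi(x_i)=\infty$ and $1/\varphi_{-1}(x_i)=\tilde p_{ii}/\tilde c_i^2<0$. $\widetilde{\mathbf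 C}_6$: $\varphi(x_i)=\infty$ and $1/\varphi_{-1}(x_i)=\tilde p_{ii}=0$. *)

theory Defs
  imports
    "HOL-Analysis.Analysis"
    "Jordan_Normal_Form.Gauss_Jordan_Elimination"
    "Jordan_Normal_Form.Schur_Decomposition"
begin

text \<open>The extended complex plane is the one-point compactification of the complex plane:
  \<^term>\<open>Some c\<close> is the finite point c and \<^term>\<open>None\<close> is the point at infinity.\<close>

definition riemann_sphere :: "complex option topology" where
  "riemann_sphere = Alexandroff_compactification euclidean"

definition sphere_divide :: "complex \<Rightarrow> complex \<Rightarrow> complex option" where
  "sphere_divide a b = (if b = 0 then None else Some (a / b))"

fun sphere_inverse :: "complex option \<Rightarrow> complex option" where
  "sphere_inverse None = Some 0"
| "sphere_inverse (Some c) = sphere_divide 1 c"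

definition upper_half_plane :: "complex set" where
  "upper_half_plane = {z. 0 < Im z}"

text \<open>Functions on the upper half plane with values in the extended plane are represented by
  total functions; their values outside the upper half plane are never used.\<close>

definition nevanlinna :: "(complex \<Rightarrow> complex option) set" where
  "nevanlinna = {\<phi>. \<exists>f. f analytic_on upper_half_plane \<and>
     (\<forall>z\<in>upper_half_plane. 0 \<le> Im (f z) \<and> \<phi> z = Some (f z))}"

definition nevanlinna_ext :: "(complex \<Rightarrow> complex option) set" where
  "nevanlinna_ext = nevanlinna \<union> {\<phi>. \<forall>z\<in>upper_half_plane. \<phi> z = None}"

definition stolz_cone :: "real \<Rightarrow> real \<Rightarrow> complex set" where
  "stolz_cone x a = {z. 0 < Im z \<and> \<bar>Re z - x\<bar> < a * Im z}"

text \<open>\<open>ntlim f x L\<close>: the nontangential limit \<open>f(x)\<close> exists in the extended plane and equals L.\<close>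

definition ntlim :: "(complex \<Rightarrow> complex option) \<Rightarrow> real \<Rightarrow> complex option \<Rightarrow> bool" where
  "ntlim f x L \<longleftrightarrow>
     (\<forall>a>0. limitin riemann_sphere f L (at (of_real x) within stolz_cone x a))"

text \<open>\<open>ntlim_m1 f x L\<close>: the limit \<open>f\<^sub>-\<^sub>1(x)\<close> exists and equals L. Since \<open>(z - x) \<infinity> = \<infinity>\<close> for
  \<open>z \<noteq> x\<close>, it is \<open>\<infinity>\<close> when f is identically \<open>\<infinity>\<close>.\<close>

definition ntlim_m1 :: "(complex \<Rightarrow> complex option) \<Rightarrow> real \<Rightarrow> complex option \<Rightarrow> bool" where
  "ntlim_m1 f x L \<longleftrightarrow> ntlim (\<lambda>z. map_option (\<lambda>c. (z - of_real x) * c) (f z)) x L"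

text \<open>\<open>inv_m1 f x t\<close>: the limit \<open>f\<^sub>-\<^sub>1(x)\<close> exists and its reciprocal is the (finite) real number t.
  The value \<open>f\<^sub>-\<^sub>1(x) = \<infinity>\<close> gives t = 0, while \<open>f\<^sub>-\<^sub>1(x) = 0\<close> gives no t.\<close>

definition inv_m1 :: "(complex \<Rightarrow> complex option) \<Rightarrow> real \<Rightarrow> real \<Rightarrow> bool" where
  "inv_m1 f x t \<longleftrightarrow> (\<exists>L. ntlim_m1 f x L \<and> sphere_inverse L = Some (of_real t))"

text \<open>Indices run from 0, so the regular nodes have indices \<open>i < num_regular\<close> and the singular
  ones \<open>num_regular \<le> i < num_nodes\<close>. The values of \<open>wval\<close>, \<open>gam\<close> are used only at the regular
  nodes and those of \<open>xi\<close> only at the singular ones.\<close>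

record pick_data =
  num_nodes :: nat
  num_regular :: nat
  node :: "nat \<Rightarrow> real"
  wval :: "nat \<Rightarrow> real"
  gam :: "nat \<Rightarrow> real"
  xi :: "nat \<Rightarrow> real"

definition pick_data_ok :: "pick_data \<Rightarrow> bool" where
  "pick_data_ok D \<longleftrightarrow>
     num_regular D \<le> num_nodes D \<and>
     inj_on (node D) {..<num_nodes D} \<and>
     (\<forall>k. num_regular D \<le> k \<and> k < num_nodes D \<longrightarrow> xi D k \<noteq> 0)"

definition pick_matrix :: "pick_data \<Rightarrow> real mat" where
  "pick_matrix D = Matrix.mat (num_nodes D) (num_nodes D) (\<lambda>(i, j).
     if i < num_regular D \<and> j < num_regular D then
       (if i = j then gam D i else (wval D j - wval D i) / (node D j - node D i))
     else if i < num_regular D then xi D j / (node D j - node D i)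
     else if j < num_regular D then xi D i / (node D i - node D j)
     else (if i = j then - xi D i else 0))"

definition pick_inverse :: "pick_data \<Rightarrow> real mat" where
  "pick_inverse D = the (mat_inverse (pick_matrix D))"

definition X_mat :: "pick_data \<Rightarrow> real mat" where
  "X_mat D = mat_diag (num_nodes D) (node D)"

definition C_row :: "pick_data \<Rightarrow> real mat" where
  "C_row D = Matrix.mat 1 (num_nodes D)
     (\<lambda>(_, j). if j < num_regular D then wval D j else xi D j)"

definition E_row :: "pick_data \<Rightarrow> real mat" where
  "E_row D = Matrix.mat 1 (num_nodes D) (\<lambda>(_, j). if j < num_regular D then 1 else 0)"

definition J_mat :: "complex mat" where
  "J_mat = mat_of_rows_list 2 [[0, - \<i>], [\<i>, 0]]"

definition CE_mat :: "pick_data \<Rightarrow> complex mat" where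
  "CE_mat D = map_mat of_real (C_row D @\<^sub>r E_row D)"

definition Theta :: "pick_data \<Rightarrow> complex \<Rightarrow> complex mat" where
  "Theta D z = 1\<^sub>m 2 - \<i> \<cdot>\<^sub>m
     (CE_mat D
       * the (mat_inverse (z \<cdot>\<^sub>m 1\<^sub>m (num_nodes D) - map_mat of_real (X_mat D)))
       * map_mat of_real (pick_inverse D)
       * mat_adjoint (CE_mat D)
       * J_mat)"

text \<open>For an invertible Pick matrix, \<open>T_Theta D \<phi>\<close> is meromorphic on the upper half plane (or
  identically \<open>\<infinity>\<close>) and takes the value \<open>\<infinity>\<close> at its poles. The pointwise quotient is never 0/0
  there, because \<open>Theta D z\<close> is an invertible matrix at every point that is not a node.\<close>

definition T_Theta :: "pick_data \<Rightarrow> (complex \<Rightarrow> complex option) \<Rightarrow> complex \<Rightarrow> complex option" where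
  "T_Theta D \<phi> z =
     (case \<phi> z of
        None \<Rightarrow> sphere_divide (Theta D z $$ (0, 0)) (Theta D z $$ (1, 0))
      | Some c \<Rightarrow> sphere_divide (Theta D z $$ (0, 0) * c + Theta D z $$ (0, 1))
                               (Theta D z $$ (1, 0) * c + Theta D z $$ (1, 1)))"

definition c_til :: "pick_data \<Rightarrow> nat \<Rightarrow> real" where
  "c_til D i = (C_row D * pick_inverse D) $$ (0, i)"

definition e_til :: "pick_data \<Rightarrow> nat \<Rightarrow> real" where
  "e_til D i = (E_row D * pick_inverse D) $$ (0, i)"

definition p_til :: "pick_data \<Rightarrow> nat \<Rightarrow> real" where
  "p_til D i = pick_inverse D $$ (i, i)"

definition cond_C1 :: "pick_data \<Rightarrow> (complex \<Rightarrow> complex option) \<Rightarrow> nat \<Rightarrow> bool" where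
  "cond_C1 D \<phi> i \<longleftrightarrow> \<not> ntlim \<phi> (node D i) None"

definition cond_C2 :: "pick_data \<Rightarrow> (complex \<Rightarrow> complex option) \<Rightarrow> nat \<Rightarrow> bool" where
  "cond_C2 D \<phi> i \<longleftrightarrow> ntlim \<phi> (node D i) None \<and> ntlim_m1 \<phi> (node D i) (Some 0)"

definition cond_C3 :: "pick_data \<Rightarrow> (complex \<Rightarrow> complex option) \<Rightarrow> nat \<Rightarrow> bool" where
  "cond_C3 D \<phi> i \<longleftrightarrow> ntlim \<phi> (node D i) None \<and>
     (\<exists>t. inv_m1 \<phi> (node D i) t \<and> - p_til D i / (c_til D i)\<^sup>2 < - t)"

definition cond_C4 :: "pick_data \<Rightarrow> (complex \<Rightarrow> complex option) \<Rightarrow> nat \<Rightarrow> bool" where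
  "cond_C4 D \<phi> i \<longleftrightarrow> ntlim \<phi> (node D i) None \<and>
     (\<exists>t. inv_m1 \<phi> (node D i) t \<and> 0 \<le> - t \<and> - t < - p_til D i / (c_til D i)\<^sup>2)"

definition cond_C5 :: "pick_data \<Rightarrow> (complex \<Rightarrow> complex option) \<Rightarrow> nat \<Rightarrow> bool" where
  "cond_C5 D \<phi> i \<longleftrightarrow> ntlim \<phi> (node D i) None \<and>
     (\<exists>t. inv_m1 \<phi> (node D i) t \<and> t = p_til D i / (c_til D i)\<^sup>2 \<and> p_til D i / (c_til D i)\<^sup>2 < 0)"

definition cond_C6 :: "pick_data \<Rightarrow> (complex \<Rightarrow> complex option) \<Rightarrow> nat \<Rightarrow> bool" where
  "cond_C6 D \<phi> i \<longleftrightarrow> ntlim \<phi> (node D i) None \<and>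
     (\<exists>t. inv_m1 \<phi> (node D i) t \<and> t = p_til D i \<and> p_til D i = 0)"

end

theory Submission
  imports Defs "HOL-Complex_Analysis.Conformal_Mappings"
begin

text \<open>
  Put \<open>u = z - x\<^sub>i\<close> and \<open>\<psi> = u \<phi>\<close>. Then \<open>u w = (A \<psi> + B) / (G \<psi> + H)\<close> with
  \<open>A = \<Theta>\<^sub>1\<^sub>1\<close>, \<open>B = u \<Theta>\<^sub>1\<^sub>2\<close>, \<open>G = \<Theta>\<^sub>2\<^sub>1 / u\<close>, \<open>H = \<Theta>\<^sub>2\<^sub>2\<close>. Since the i-th entry of
  \<open>E P\<^sup>-\<^sup>1\<close> vanishes, the displacement identity for \<open>P\<close> shows that all four coefficients have finite
  limits at \<open>x\<^sub>i\<close>, namely \<open>\<xi> p / c\<close>, \<open>- \<xi> c\<close>, \<open>(1 + \<xi> p) / (\<xi> c)\<close> and \<open>- c\<close>, forming a matrix of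
  determinant 1. Hence \<open>w\<^sub>-\<^sub>1(x\<^sub>i)\<close> is the image of \<open>\<phi>\<^sub>-\<^sub>1(x\<^sub>i)\<close> under a fixed real Moebius map. The
  latter limit always exists in \<open>[-\<infinity>, 0]\<close> by the Julia-Caratheodory theorem, which follows from the
  Schwarz-Pick inequality, and the four equivalences become real arithmetic.
\<close>

subsection \<open>Limits on the Riemann sphere\<close>

lemma Hausdorff_riemann_sphere: "Hausdorff_space riemann_sphere"
  unfolding riemann_sphere_def Hausdorff_space_Alexandroff_compactification
  by (simp add: locally_compact_space_euclidean)

lemma limitin_riemann_sphere_Some:
  assumes "((\<lambda>z. h z) \<longlongrightarrow> l) F" "eventually (\<lambda>z. f z = Some (h z)) F"
  shows "limitin riemann_sphere f (Some l) F"
proof -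
  have "limitin riemann_sphere (\<lambda>z. Some (h z)) (Some l) F"
    unfolding riemann_sphere_def
    using continuous_map_limit[OF continuous_map_Some, of euclidean h l F] assms(1)
    by (simp add: comp_def)
  thus ?thesis
    by (rule limitin_transform_eventually[rotated]) (use assms(2) in \<open>auto elim: eventually_mono\<close>)
qed

text \<open>Neighbourhoods of \<open>None\<close> are complements of compact sets, and compact sets
  are bounded. The premise concerns only finite values, so poles of \<open>f\<close> along the way
  are harmless.\<close>

lemma limitin_riemann_sphere_None:
  assumes "\<And>M. eventually (\<lambda>z. \<forall>c. f z = Some c \<longrightarrow> M < norm c) F"
  shows "limitin riemann_sphere f None F"
  unfolding limitin_def
proof (intro conjI allI impI)
  show "None \<in> topspace riemann_sphere"
    by (simp add: riemann_sphere_def)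
  fix U assume U: "openin riemann_sphere U \<and> None \<in> U"
  then obtain K where K: "compact K" "U = insert None (Some ` (- K))"
    by (auto simp: riemann_sphere_def openin_Alexandroff_compactification Compl_eq_Diff_UNIV)
  then obtain M where M: "\<And>c. c \<in> K \<Longrightarrow> norm c \<le> M"
    by (meson bounded_iff compact_imp_bounded)
  show "eventually (\<lambda>z. f z \<in> U) F"
    using assms[of M]
  proof eventually_elim
    case (elim z)
    show ?case
    proof (cases "f z")
      case (Some c)
      with elim M[of c] have "c \<notin> K" by force
      thus ?thesis using Some K by auto
    qed (use U in auto)
  qed
qed

text \<open>A quotient is treated as a point in homogeneous coordinates, so poles are allowed and
  only 0/0 in the limit is excluded. For \<open>q0 = 0\<close>,
  \<open>norm (p z) - M * norm (q z)\<close> tends to \<open>norm p0 > 0\<close>, so the quotient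
  exceeds every \<open>M\<close>.\<close>

lemma limitin_sphere_divide:
  assumes p: "(p \<longlongrightarrow> p0) F" and q: "(q \<longlongrightarrow> q0) F" and nz: "p0 \<noteq> 0 \<or> q0 \<noteq> 0"
  shows "limitin riemann_sphere (\<lambda>z. sphere_divide (p z) (q z)) (sphere_divide p0 q0) F"
proof (cases "q0 = 0")
  case False
  have "eventually (\<lambda>z. q z \<noteq> 0) F"
    using tendsto_imp_eventually_ne[OF q False] .
  hence "eventually (\<lambda>z. sphere_divide (p z) (q z) = Some (p z / q z)) F"
    by eventually_elim (simp add: sphere_divide_def)
  from limitin_riemann_sphere_Some[OF tendsto_divide[OF p q False] this]
  show ?thesis using False by (simp add: sphere_divide_def)
next
  case True
  with nz have p0: "p0 \<noteq> 0" by simp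
  have "limitin riemann_sphere (\<lambda>z. sphere_divide (p z) (q z)) None F"
  proof (rule limitin_riemann_sphere_None)
    fix M :: real
    have "((\<lambda>z. norm (p z) - M * norm (q z)) \<longlongrightarrow> norm p0 - M * norm q0) F"
      by (intro tendsto_intros p q)
    hence "eventually (\<lambda>z. norm (p z) - M * norm (q z) > 0) F"
      using True p0 by (intro order_tendstoD(1)) auto
    thus "eventually (\<lambda>z. \<forall>c. sphere_divide (p z) (q z) = Some c \<longrightarrow> M < norm c) F"
      by eventually_elim (auto simp: sphere_divide_def norm_divide pos_less_divide_eq)
  qed
  thus ?thesis using True by (simp add: sphere_divide_def)
qed

section \<open>Nontangential limits\<close>

lemma at_within_stolz_cone_nontrivial:
  assumes "0 < a"
  shows "at (of_real x) within stolz_cone x a \<noteq> bot"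
  unfolding trivial_limit_within islimpt_approachable not_not
proof (intro allI impI)
  fix e :: real assume "0 < e"
  thus "\<exists>z\<in>stolz_cone x a. z \<noteq> of_real x \<and> dist z (of_real x) < e"
    \<comment> \<open>The vertical segment above \<open>x\<close> lies in every cone.\<close>
    using assms by (intro bexI[of _ "Complex x (e/2)"])
      (auto simp: stolz_cone_def dist_norm cmod_def complex_eq_iff)
qed

lemma ntlim_unique:
  assumes "ntlim f x L" "ntlim f x L'"
  shows "L = L'"
  using assms unfolding ntlim_def
  by (intro limitin_Hausdorff_unique[OF _ _ at_within_stolz_cone_nontrivial[of 1 x]
      Hausdorff_riemann_sphere, of f]) auto

lemma eventually_stolz_cone:
  "eventually (\<lambda>z. 0 < Im z \<and> norm (z - of_real x) < (1 + a) * Im z) (at (of_real x) within stolz_cone x a)"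
  unfolding eventually_at_filter
proof (intro always_eventually allI impI)
  fix z assume "z \<in> stolz_cone x a"
  hence *: "0 < Im z" "\<bar>Re z - x\<bar> < a * Im z" by (auto simp: stolz_cone_def)
  have "norm (z - of_real x) \<le> \<bar>Re z - x\<bar> + \<bar>Im z\<bar>"
    using cmod_le[of "z - of_real x"] by simp
  with * show "0 < Im z \<and> norm (z - of_real x) < (1 + a) * Im z"
    by (simp add: algebra_simps)
qed

lemma eventually_at_stolz_cone:
  assumes "\<And>z. 0 < Im z \<Longrightarrow> R z"
  shows "eventually R (at (of_real x) within stolz_cone x a)"
  using eventually_stolz_cone[of x a] by eventually_elim (use assms in auto)

text \<open>\<open>f\<close> is the quotient of \<open>(z - x) * f z\<close>, which has a nonzero
  limit, by \<open>z - x\<close>, which tends to 0.\<close>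

lemma ntlim_infinity:
  assumes f: "\<And>z. 0 < Im z \<Longrightarrow> \<phi> z = Some (f z)" and "\<kappa> \<noteq> 0"
    and lim: "\<And>a. 0 < a \<Longrightarrow>
       ((\<lambda>z. (z - of_real x) * f z) \<longlongrightarrow> of_real (- \<kappa>)) (at (of_real x) within stolz_cone x a)"
  shows "ntlim \<phi> x None"
  unfolding ntlim_def
proof (intro allI impI)
  fix a :: real assume a: "0 < a"
  let ?F = "at (of_real x) within stolz_cone x a"
  have "((\<lambda>z. z - of_real x) \<longlongrightarrow> 0) ?F"
    by (rule tendsto_eq_intros refl | simp)+
  from limitin_sphere_divide[OF lim[OF a] this]
  have "limitin riemann_sphere (\<lambda>z. sphere_divide ((z - of_real x) * f z) (z - of_real x)) None ?F"
    using \<open>\<kappa> \<noteq> 0\<close> by (simp add: sphere_divide_def)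
  moreover have "\<forall>\<^sub>F z in ?F. sphere_divide ((z - of_real x) * f z) (z - of_real x) = \<phi> z"
    by (rule eventually_at_stolz_cone) (auto simp: sphere_divide_def f)
  ultimately show "limitin riemann_sphere \<phi> None ?F"
    by (rule limitin_transform_eventually[rotated])
qed

text \<open>By uniqueness of limits, homogeneous coordinates of the limit reduce every question
  about its value to real arithmetic.\<close>

lemma ntlim_m1_ratio_iff:
  assumes lim: "ntlim_m1 f x (sphere_divide (of_real a) (of_real b))"
  shows "ntlim_m1 f x (Some (of_real y)) \<longleftrightarrow> b \<noteq> 0 \<and> a = y * b"
proof -
  have "ntlim_m1 f x (Some (of_real y)) \<longleftrightarrow> sphere_divide (of_real a) (of_real b) = Some (of_real y)"
    using lim ntlim_unique unfolding ntlim_m1_def by metis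
  also have "\<dots> \<longleftrightarrow> b \<noteq> 0 \<and> complex_of_real (a / b) = of_real y"
    by (simp add: sphere_divide_def)
  also have "\<dots> \<longleftrightarrow> b \<noteq> 0 \<and> a / b = y"
    by (simp only: of_real_eq_iff)
  also have "\<dots> \<longleftrightarrow> b \<noteq> 0 \<and> a = y * b"
    by (auto simp: field_simps)
  finally show ?thesis .
qed

text \<open>Inversion swaps the coordinates. The pair 0, 0 must be excluded because
  \<open>sphere_divide\<close> sends it to \<open>None\<close> in either order.\<close>

lemma inv_m1_ratio_iff:
  assumes lim: "ntlim_m1 f x (sphere_divide (of_real a) (of_real b))" and nz: "a \<noteq> 0 \<or> b \<noteq> 0"
  shows "inv_m1 f x t \<longleftrightarrow> a \<noteq> 0 \<and> t = b / a"
proof -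
  have "inv_m1 f x t \<longleftrightarrow> sphere_inverse (sphere_divide (of_real a) (of_real b)) = Some (of_real t)"
    using lim ntlim_unique unfolding inv_m1_def ntlim_m1_def by metis
  also have "sphere_inverse (sphere_divide (of_real a) (of_real b)) =
      sphere_divide (of_real b) (of_real a)"
    using nz by (auto simp: sphere_divide_def)
  also have "\<dots> = Some (of_real t) \<longleftrightarrow> a \<noteq> 0 \<and> complex_of_real (b / a) = of_real t"
    by (simp add: sphere_divide_def)
  also have "\<dots> \<longleftrightarrow> a \<noteq> 0 \<and> t = b / a"
    by (auto simp only: of_real_eq_iff)
  finally show ?thesis .
qed

subsection \<open>The Julia-Caratheodory theorem\<close>

text \<open>Links the pseudohyperbolic distance \<open>norm (a - b) / norm (a - cnj b)\<close> to
  imaginary parts.\<close>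

lemma norm_diff_cnj_squared:
  "(norm (a - cnj b))\<^sup>2 = (norm (a - b))\<^sup>2 + 4 * Im a * Im b"
  by (simp add: cmod_power2) (simp add: power2_eq_square algebra_simps)

text \<open>Cayley transforms on both sides carry \<open>g\<close> to a self-map of the disc fixing
  0, to which the Schwarz lemma applies.\<close>

lemma Schwarz_Pick_upper_half_plane:
  assumes hol: "g holomorphic_on upper_half_plane"
    and pos: "\<And>z. 0 < Im z \<Longrightarrow> 0 < Im (g z)"
    and z: "0 < Im z" and z0: "0 < Im z0"
  shows "(norm (g z - g z0))\<^sup>2 * (Im z * Im z0) \<le> Im (g z) * Im (g z0) * (norm (z - z0))\<^sup>2"
proof -
  \<comment> \<open>\<open>C\<close> inverts the Cayley map \<open>(z - z0) / (z - cnj z0)\<close>;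
    \<open>F\<close> is \<open>g\<close> read in disc coordinates.\<close>
  define C where "C = (\<lambda>\<zeta>. (z0 - cnj z0 * \<zeta>) / (1 - \<zeta>))"
  define F where "F = (\<lambda>\<zeta>. (g (C \<zeta>) - g z0) / (g (C \<zeta>) - cnj (g z0)))"
  have lt: "norm (a - b) < norm (a - cnj b)" if "0 < Im a" "0 < Im b" for a b
  proof (rule power_less_imp_less_base[of _ 2])
    have "0 < 4 * Im a * Im b" using that by simp
    thus "(norm (a - b))\<^sup>2 < (norm (a - cnj b))\<^sup>2"
      unfolding norm_diff_cnj_squared[of a b] by linarith
  qed simp
  have ne: "a - cnj b \<noteq> 0" if "0 < Im a" "0 < Im b" for a b
  proof -
    have "Im (a - cnj b) \<noteq> 0" using that by simp
    thus ?thesis by (metis zero_complex.sel(2))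
  qed
  have C_UHP: "0 < Im (C \<zeta>)" if "norm \<zeta> < 1" for \<zeta>
  proof -
    have 1: "1 - \<zeta> \<noteq> 0" using that by auto
    have d: "z0 - cnj z0 \<noteq> 0" using ne[OF z0 z0] .
    \<comment> \<open>This factor, common to both differences, shows that \<open>C \<zeta>\<close>
      is closer to \<open>z0\<close> than to \<open>cnj z0\<close>, hence in the upper half
      plane.\<close>
    define q where "q = (z0 - cnj z0) / (1 - \<zeta>)"
    have q: "q \<noteq> 0" using 1 d by (simp add: q_def)
    have e1: "C \<zeta> - z0 = \<zeta> * q"
      using 1 by (simp add: C_def q_def field_simps)
    have e2: "C \<zeta> - cnj z0 = q"
      using 1 by (simp add: C_def q_def field_simps)
    have "norm (C \<zeta> - z0) < norm (C \<zeta> - cnj z0)"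
      unfolding e1 e2 norm_mult using mult_strict_right_mono[OF that, of "norm q"] q by simp
    hence "(norm (C \<zeta> - z0))\<^sup>2 < (norm (C \<zeta> - cnj z0))\<^sup>2"
      by (intro power_strict_mono) auto
    thus ?thesis using norm_diff_cnj_squared[of "C \<zeta>" z0] z0 by (simp add: zero_less_mult_iff)
  qed
  have hC: "C holomorphic_on ball 0 1"
    unfolding C_def by (intro holomorphic_intros) auto
  have hgC: "(\<lambda>\<zeta>. g (C \<zeta>)) holomorphic_on ball 0 1"
    using holomorphic_on_compose_gen[OF hC hol] by (force simp: upper_half_plane_def C_UHP comp_def)
  have hF: "F holomorphic_on ball 0 1"
    unfolding F_def
    by (intro holomorphic_on_divide holomorphic_on_diff hgC holomorphic_on_const
        ne pos C_UHP z0) auto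
  have F0: "F 0 = 0" by (simp add: F_def C_def)
  have F1: "norm (F \<zeta>) < 1" if "norm \<zeta> < 1" for \<zeta>
    unfolding F_def norm_divide
    using divide_less_eq_1_pos[THEN iffD2, OF _ lt[OF pos[OF C_UHP[OF that]] pos[OF z0]]]
      ne[OF pos[OF C_UHP[OF that]] pos[OF z0]] by simp
  define \<zeta> where "\<zeta> = (z - z0) / (z - cnj z0)"
  have \<zeta>1: "norm \<zeta> < 1"
    unfolding \<zeta>_def norm_divide
    using divide_less_eq_1_pos[THEN iffD2, OF _ lt[OF z z0]] ne[OF z z0] by simp
  have dz: "z - cnj z0 \<noteq> 0" using ne[OF z z0] .
  have d0: "z0 - cnj z0 \<noteq> 0" using ne[OF z0 z0] .
  have n: "1 - \<zeta> = (z0 - cnj z0) / (z - cnj z0)"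
    using dz by (simp add: \<zeta>_def field_simps)
  have n': "z0 - cnj z0 * \<zeta> = z * (z0 - cnj z0) / (z - cnj z0)"
    using dz by (simp add: \<zeta>_def field_simps)
  have Cz: "C \<zeta> = z"
    unfolding C_def n n' using dz d0 by simp
  have dg: "g z - cnj (g z0) \<noteq> 0" using ne[OF pos[OF z] pos[OF z0]] .
  have "norm (g z - g z0) / norm (g z - cnj (g z0)) \<le> norm (z - z0) / norm (z - cnj z0)"
    using Schwarz_Lemma(1)[OF hF F0 F1 \<zeta>1] unfolding F_def Cz by (simp only: \<zeta>_def norm_divide)
  hence "norm (g z - g z0) * norm (z - cnj z0) \<le> norm (z - z0) * norm (g z - cnj (g z0))"
  proof -
    have "a * d \<le> c * b" if "a / b \<le> c / d" "0 < b" "0 < d" for a b c d :: real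
      using that by (simp add: field_simps)
    thus "norm (g z - g z0) / norm (g z - cnj (g z0)) \<le> norm (z - z0) / norm (z - cnj z0) \<Longrightarrow> ?thesis"
      using dg dz by simp
  qed
  hence "(norm (g z - g z0) * norm (z - cnj z0))\<^sup>2 \<le> (norm (z - z0) * norm (g z - cnj (g z0)))\<^sup>2"
    by (intro power_mono) auto
  \<comment> \<open>The product \<open>|g z - g z0|^2 |z - z0|^2\<close> occurs on both sides and
    cancels.\<close>
  thus ?thesis
    unfolding power_mult_distrib norm_diff_cnj_squared by (simp add: algebra_simps)
qed

text \<open>If \<open>D > m\<close>, then \<open>D + m\<close> is below \<open>2 * D\<close> and one
  factor \<open>D\<close> cancels.\<close>

lemma le_of_power2_le_mult_add:
  fixes D b m :: real
  assumes "D\<^sup>2 \<le> b * (D + m)" "0 \<le> b" "0 \<le> m" "0 \<le> D"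
  shows "D \<le> 2 * b + m"
proof (cases "D \<le> m")
  case False
  hence "b * m \<le> b * D" using assms by (intro mult_left_mono) auto
  hence "D\<^sup>2 \<le> (2 * b) * D" using assms(1) by (simp add: distrib_left)
  moreover have "0 < D" using False assms by simp
  ultimately have "D \<le> 2 * b" by (simp add: power2_eq_square)
  with assms show ?thesis by simp
qed (use assms in auto)

lemma Im_inverse_of_real_diff: "Im (1 / (z - of_real x)) = - Im z / (norm (z - of_real x))\<^sup>2"
  by (simp add: Im_divide cmod_power2)

text \<open>\<open>\<kappa>\<close> is the largest constant for which adding
  \<open>\<kappa> / (z - x)\<close> to \<open>f\<close> keeps the imaginary part nonnegative.
  Schwarz-Pick based at a near-minimiser shows that what remains is negligible against
  \<open>1 / (z - x)\<close> inside a cone.\<close>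

proposition Julia_Caratheodory_upper_half_plane:
  assumes hol: "f holomorphic_on upper_half_plane"
    and nonneg: "\<And>z. 0 < Im z \<Longrightarrow> 0 \<le> Im (f z)"
  obtains \<kappa> :: real where "0 \<le> \<kappa>"
    "\<And>a. 0 < a \<Longrightarrow>
       ((\<lambda>z. (z - of_real x) * f z) \<longlongrightarrow> of_real (- \<kappa>)) (at (of_real x) within stolz_cone x a)"
proof -
  define r where "r = (\<lambda>z. norm (z - complex_of_real x))"
  have r_pos: "0 < r z" if "0 < Im z" for z
    using that by (auto simp: r_def complex_eq_iff)
  define S where "S = (\<lambda>z. Im (f z) * (r z)\<^sup>2 / Im z) ` upper_half_plane"
  define \<kappa> where "\<kappa> = Inf S"
  have S_nonneg: "0 \<le> s" if "s \<in> S" for s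
    using that nonneg by (auto simp: S_def upper_half_plane_def)
  have S_ne: "S \<noteq> {}"
    by (auto simp: S_def upper_half_plane_def intro!: exI[of _ \<i>])
  have bdd: "bdd_below S" using S_nonneg by (meson bdd_belowI)
  have "0 \<le> \<kappa>" unfolding \<kappa>_def by (rule cInf_greatest[OF S_ne S_nonneg])
  moreover have "((\<lambda>z. (z - of_real x) * f z) \<longlongrightarrow> of_real (- \<kappa>)) (at (of_real x) within stolz_cone x a)"
    if a: "0 < a" for a
  proof (rule tendstoI)
    fix e :: real assume e: "0 < e"
    \<comment> \<open>Half of \<open>e\<close> absorbs the terms proportional to
      \<open>\<epsilon>\<close>, the other half the term \<open>2 * m * r z\<close>.\<close>
    define \<epsilon> where "\<epsilon> = e / 2 / (1 + 16 * (1 + a))"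
    have \<epsilon>: "0 < \<epsilon>" using e a by (simp add: \<epsilon>_def)
    have "\<epsilon> * (1 + 16 * (1 + a)) = e / 2"
      using a \<epsilon>_def by (subst (asm) nonzero_eq_divide_eq) auto
    hence \<epsilon>e: "\<epsilon> + 16 * \<epsilon> * (1 + a) = e / 2" by (simp add: algebra_simps)
    \<comment> \<open>Using \<open>\<kappa> - \<epsilon>\<close> instead of \<open>\<kappa>\<close>
      keeps \<open>Im g\<close> strictly positive, as Schwarz-Pick requires.\<close>
    define g where "g = (\<lambda>z. f z + of_real (\<kappa> - \<epsilon>) * (1 / (z - of_real x)))"
    have Im_g: "Im (g z) = (Im z / (r z)\<^sup>2) * (Im (f z) * (r z)\<^sup>2 / Im z - \<kappa> + \<epsilon>)"
      if "0 < Im z" for z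
    proof -
      have "Im (g z) = Im (f z) + (\<kappa> - \<epsilon>) * Im (1 / (z - of_real x))"
        by (simp only: g_def plus_complex.sel times_complex.sel Re_complex_of_real
            Im_complex_of_real mult_zero_left add_0_right)
      also have "Im (1 / (z - of_real x)) = - Im z / (r z)\<^sup>2"
        by (simp only: Im_inverse_of_real_diff r_def)
      finally have eq: "Im (g z) = Im (f z) + (\<kappa> - \<epsilon>) * (- Im z / (r z)\<^sup>2)" .
      show ?thesis
        unfolding eq using that r_pos[OF that] by (simp add: field_simps)
    qed
    have g_pos: "0 < Im (g z)" if "0 < Im z" for z
    proof -
      have "\<kappa> \<le> Im (f z) * (r z)\<^sup>2 / Im z"
        unfolding \<kappa>_def using that by (intro cInf_lower[OF _ bdd]) (auto simp: S_def upper_half_plane_def)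
      thus ?thesis unfolding Im_g[OF that] using that r_pos[OF that] \<epsilon>
        by (intro mult_pos_pos divide_pos_pos) auto
    qed
    \<comment> \<open>At a near-minimiser \<open>z0\<close> of the infimum, \<open>Im (g z0)\<close>
      is of order \<open>\<epsilon>\<close>.\<close>
    obtain s where s: "s \<in> S" "s < \<kappa> + \<epsilon>"
      using cInf_lessD[OF S_ne, of "\<kappa> + \<epsilon>"] \<epsilon> by (auto simp: \<kappa>_def)
    then obtain z0 where z0: "0 < Im z0" "Im (f z0) * (r z0)\<^sup>2 / Im z0 < \<kappa> + \<epsilon>"
      by (auto simp: S_def upper_half_plane_def)
    have g0: "Im (g z0) \<le> (Im z0 / (r z0)\<^sup>2) * (2 * \<epsilon>)"
      unfolding Im_g[OF z0(1)] using z0 by (intro mult_left_mono) auto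
    have hg: "g holomorphic_on upper_half_plane"
      unfolding g_def by (intro holomorphic_intros hol) (auto simp: upper_half_plane_def)
    define m where "m = norm (g z0)"
    \<comment> \<open>The restriction on \<open>r z\<close> gives
      \<open>norm (z - z0) \<le> 2 * r z0\<close>, whose square cancels the \<open>(r z0)^2\<close>
      in \<open>g0\<close>. The constant 16 is 2 from \<open>g0\<close>, 4 from this square and 2
      from the quadratic estimate.\<close>
    have main: "norm (g z) \<le> 2 * m + 16 * \<epsilon> / Im z" if z: "0 < Im z" "r z \<le> r z0" for z
    proof -
      define D where "D = norm (g z - g z0)"
      have "norm (z - z0) \<le> r z + r z0"
        using norm_triangle_ineq4[of "z - of_real x" "z0 - of_real x"] by (simp add: r_def)
      also have "\<dots> \<le> 2 * r z0" using z by simp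
      finally have "(norm (z - z0))\<^sup>2 \<le> (2 * r z0)\<^sup>2" by (intro power_mono) auto
      hence R: "(norm (z - z0))\<^sup>2 \<le> 4 * (r z0)\<^sup>2" by simp
      have "D\<^sup>2 * (Im z * Im z0) \<le> Im (g z) * Im (g z0) * (norm (z - z0))\<^sup>2"
        unfolding D_def by (rule Schwarz_Pick_upper_half_plane[OF hg g_pos z(1) z0(1)])
      also have "\<dots> \<le> (D + m) * ((Im z0 / (r z0)\<^sup>2) * (2 * \<epsilon>)) * (4 * (r z0)\<^sup>2)"
      proof (intro mult_mono R g0)
        have "Im (g z) \<le> norm (g z)" by (rule order.trans[OF abs_ge_self abs_Im_le_cmod])
        also have "\<dots> \<le> D + m" using norm_triangle_ineq[of "g z - g z0" "g z0"] by (simp add: D_def m_def)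
        finally show "Im (g z) \<le> D + m" .
      qed (use g_pos[OF z(1)] g_pos[OF z0(1)] z0(1) \<epsilon> in \<open>auto simp: D_def m_def\<close>)
      also have "\<dots> = (8 * \<epsilon>) * (D + m) * Im z0"
        using r_pos[OF z0(1)] by (simp add: field_simps)
      finally have "D\<^sup>2 * Im z * Im z0 \<le> (8 * \<epsilon>) * (D + m) * Im z0"
        by (simp only: mult.assoc)
      hence "D\<^sup>2 * Im z \<le> (8 * \<epsilon>) * (D + m)"
        using z0(1) by (rule mult_right_le_imp_le)
      hence "D\<^sup>2 \<le> (8 * \<epsilon> / Im z) * (D + m)"
        using z(1) by (simp add: pos_le_divide_eq)
      hence "D \<le> 2 * (8 * \<epsilon> / Im z) + m"
        by (rule le_of_power2_le_mult_add) (use \<epsilon> z in \<open>auto simp: D_def m_def\<close>)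
      moreover have "norm (g z) \<le> D + m"
        using norm_triangle_ineq[of "g z - g z0" "g z0"] by (simp add: D_def m_def)
      ultimately show ?thesis by simp
    qed
    have r_lim: "(r \<longlongrightarrow> 0) (at (of_real x) within stolz_cone x a)"
      unfolding r_def by (auto intro!: tendsto_eq_intros)
    have ev1: "eventually (\<lambda>z. r z < r z0) (at (of_real x) within stolz_cone x a)"
      using order_tendstoD(2)[OF r_lim r_pos[OF z0(1)]] .
    have ev2: "eventually (\<lambda>z. 2 * m * r z < e / 2) (at (of_real x) within stolz_cone x a)"
      using e by (intro order_tendstoD(2)[of _ "2 * m * 0"] tendsto_intros r_lim) auto
    show "eventually (\<lambda>z. dist ((z - of_real x) * f z) (of_real (- \<kappa>)) < e)
       (at (of_real x) within stolz_cone x a)"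
      using ev1 ev2 eventually_stolz_cone[of x a]
    proof eventually_elim
      case (elim z)
      hence z: "0 < Im z" "r z < (1 + a) * Im z" by (auto simp: r_def)
      have zx: "z - of_real x \<noteq> 0" using z by (auto simp: complex_eq_iff)
      have "(z - of_real x) * f z + of_real \<kappa> = (z - of_real x) * g z + of_real \<epsilon>"
        using zx by (simp add: g_def field_simps)
      hence "dist ((z - of_real x) * f z) (of_real (- \<kappa>)) = norm ((z - of_real x) * g z + of_real \<epsilon>)"
        by (simp add: dist_norm)
      also have "\<dots> \<le> r z * norm (g z) + \<epsilon>"
        using norm_triangle_ineq[of "(z - of_real x) * g z" "of_real \<epsilon>"] \<epsilon> by (simp add: norm_mult r_def)
      also have "r z * norm (g z) \<le> r z * (2 * m + 16 * \<epsilon> / Im z)"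
        using main[OF z(1)] elim by (intro mult_left_mono) (auto simp: r_def)
      also have "\<dots> = 2 * m * r z + 16 * \<epsilon> * (r z / Im z)" by (simp add: algebra_simps)
      \<comment> \<open>The aperture enters here: \<open>r z / Im z\<close> stays below
        \<open>1 + a\<close> in the cone.\<close>
      also have "16 * \<epsilon> * (r z / Im z) \<le> 16 * \<epsilon> * (1 + a)"
        using z \<epsilon> by (intro mult_left_mono) (auto simp: field_simps)
      finally show ?case using elim \<epsilon>e by simp
    qed
  qed
  ultimately show ?thesis using that by blast
qed

subsection \<open>The transfer matrix\<close>

text \<open>A two-sided inverse makes \<open>A\<close> a unit, which excludes \<open>None\<close>;
  the rest is uniqueness of inverses.\<close>

lemma mat_inverse_eqI:
  fixes A :: "'a :: field mat"
  assumes "A \<in> carrier_mat n n" "B \<in> carrier_mat n n" "A * B = 1\<^sub>m n" "B * A = 1\<^sub>m n"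
  shows "mat_inverse A = Some B"
proof (cases "mat_inverse A")
  case None
  have "A \<in> Units (ring_mat TYPE('a) n ())"
    using assms by (auto simp: Units_def ring_mat_def)
  with mat_inverse(1)[OF assms(1) None, where b = "()"] show ?thesis by blast
next
  case (Some B')
  note B' = mat_inverse(2)[OF assms(1) Some]
  have "B' = B' * (A * B)"
    unfolding assms(3) using B' by (intro right_mult_one_mat[symmetric, of _ n n]) simp
  also have "\<dots> = (B' * A) * B"
    using B' assms by (intro assoc_mult_mat[symmetric, of _ n n _ n _ n]) auto
  also have "\<dots> = B" using B' assms by simp
  finally show ?thesis using Some by simp
qed

text \<open>Scalar entries turn the matrix identities below into finite sums over indices.\<close>

definition C_entry :: "pick_data \<Rightarrow> nat \<Rightarrow> real" where
  "C_entry D j = (if j < num_regular D then wval D j else xi D j)"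

definition E_entry :: "pick_data \<Rightarrow> nat \<Rightarrow> real" where
  "E_entry D j = (if j < num_regular D then 1 else 0)"

locale invertible_pick =
  fixes D :: pick_data
  assumes ok: "pick_data_ok D" and inv: "invertible_mat (pick_matrix D)"
begin

abbreviation "n \<equiv> num_nodes D"
abbreviation "P \<equiv> pick_matrix D"
abbreviation "Q \<equiv> pick_inverse D"

lemma node_neq: "i < n \<Longrightarrow> j < n \<Longrightarrow> i \<noteq> j \<Longrightarrow> node D i \<noteq> node D j"
  using ok by (auto simp: pick_data_ok_def inj_on_def)

lemma P_carrier [simp]: "P \<in> carrier_mat n n"
  by (simp add: pick_matrix_def)

lemma
  shows Q_carrier [simp]: "Q \<in> carrier_mat n n"
    and PQ: "P * Q = 1\<^sub>m n"
    and QP: "Q * P = 1\<^sub>m n"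
proof -
  obtain B where B: "P * B = 1\<^sub>m n" "B * P = 1\<^sub>m (dim_row B)"
    using inv carrier_matD[OF P_carrier] by (auto simp: invertible_mat_def inverts_mat_def)
  \<comment> \<open>\<open>invertible_mat\<close> leaves the dimensions of \<open>B\<close> open;
    those of the two products determine them.\<close>
  have "dim_col B = n" using B(1) by (metis index_mult_mat(3) index_one_mat(3))
  moreover have "dim_row B = n"
    using B(2) by (metis carrier_matD(2) P_carrier index_mult_mat(3) index_one_mat(3))
  ultimately have "B \<in> carrier_mat n n" by auto
  with B have "mat_inverse P = Some B" by (intro mat_inverse_eqI[of _ n]) auto
  with \<open>B \<in> carrier_mat n n\<close> B show "Q \<in> carrier_mat n n" "P * Q = 1\<^sub>m n" "Q * P = 1\<^sub>m n"
    by (auto simp: pick_inverse_def)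
qed

section \<open>Symmetry and displacement identities of the Pick matrix and its inverse\<close>

lemma P_sym: "i < n \<Longrightarrow> j < n \<Longrightarrow> P $$ (i, j) = P $$ (j, i)"
  by (auto simp: pick_matrix_def) (metis minus_diff_eq minus_divide_divide)

lemma P_row_singular:
  "\<lbrakk>num_regular D \<le> i; i < n; j < n\<rbrakk> \<Longrightarrow>
     P $$ (i, j) = (if i = j then - xi D i else xi D i * E_entry D j / (node D i - node D j))"
  by (auto simp: pick_matrix_def E_entry_def)

text \<open>Entrywise form of \<open>P X - X P = E^T C - C^T E\<close>. On the diagonal both sides
  vanish; elsewhere the denominators of \<open>P\<close> cancel.\<close>

lemma displacement:
  assumes "i < n" "j < n"
  shows "P $$ (i, j) * (node D j - node D i) = E_entry D i * C_entry D j - C_entry D i * E_entry D j"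
proof (cases "i = j")
  case False
  hence "node D j - node D i \<noteq> 0" "node D i - node D j \<noteq> 0" using node_neq assms by fastforce+
  thus ?thesis using assms False
    by (auto simp: pick_matrix_def E_entry_def C_entry_def divide_simps algebra_simps)
qed simp

text \<open>As \<open>P\<close> is symmetric, the transpose of \<open>Q\<close> is also a left
  inverse of it.\<close>

lemma Q_sym:
  assumes "i < n" "j < n"
  shows "Q $$ (i, j) = Q $$ (j, i)"
proof -
  have PT: "transpose_mat P = P"
    by (rule eq_matI) (use P_carrier P_sym in \<open>auto simp del: P_carrier\<close>)
  have "transpose_mat (P * Q) = transpose_mat Q * P"
    by (simp add: transpose_mult[of _ n n _ n] PT)
  hence 1: "transpose_mat Q * P = 1\<^sub>m n" by (simp add: PQ)
  have "transpose_mat Q = transpose_mat Q * (P * Q)"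
    unfolding PQ by (rule right_mult_one_mat[symmetric, of _ n n]) simp
  also have "\<dots> = (transpose_mat Q * P) * Q"
    by (rule assoc_mult_mat[symmetric, of _ n n _ n _ n]) auto
  also have "\<dots> = Q" unfolding 1 by (rule left_mult_one_mat[of _ n n]) simp
  finally have "transpose_mat Q $$ (i, j) = Q $$ (i, j)" by simp
  thus ?thesis using assms Q_carrier by (auto simp del: Q_carrier)
qed

lemma PQ_entry:
  "i < n \<Longrightarrow> j < n \<Longrightarrow> (\<Sum>k<n. P $$ (i, k) * Q $$ (k, j)) = (if i = j then 1 else 0)"
  using arg_cong[OF PQ, of "\<lambda>M. M $$ (i, j)"] P_carrier Q_carrier
  by (simp add: scalar_prod_def atLeast0LessThan del: P_carrier Q_carrier)

lemma c_til_eq: "j < n \<Longrightarrow> c_til D j = (\<Sum>k<n. C_entry D k * Q $$ (k, j))"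
  using Q_carrier
  by (simp add: c_til_def C_row_def scalar_prod_def atLeast0LessThan C_entry_def del: Q_carrier)

lemma e_til_eq: "j < n \<Longrightarrow> e_til D j = (\<Sum>k<n. E_entry D k * Q $$ (k, j))"
  using Q_carrier
  by (simp add: e_til_def E_row_def scalar_prod_def atLeast0LessThan E_entry_def del: Q_carrier)

text \<open>Symmetry of \<open>Q\<close> lets the row \<open>v Q\<close> serve as the column
  \<open>Q v\<close>, which \<open>P\<close> maps back to \<open>v\<close>.\<close>

lemma sum_PQ:
  assumes "i < n" "\<And>j. j < n \<Longrightarrow> s j = (\<Sum>k<n. v k * Q $$ (k, j))"
  shows "(\<Sum>j<n. P $$ (i, j) * s j) = v i"
proof -
  have "(\<Sum>j<n. P $$ (i, j) * s j) = (\<Sum>j<n. \<Sum>k<n. v k * (P $$ (i, j) * Q $$ (j, k)))"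
    by (intro sum.cong refl) (auto simp: assms(2) sum_distrib_left Q_sym intro!: sum.cong)
  also have "\<dots> = (\<Sum>k<n. v k * (\<Sum>j<n. P $$ (i, j) * Q $$ (j, k)))"
    by (subst sum.swap) (simp add: sum_distrib_left)
  also have "\<dots> = (\<Sum>k<n. v k * (if i = k then 1 else 0))"
    using assms(1) by (intro sum.cong refl) (simp add: PQ_entry)
  also have "\<dots> = v i" using assms(1) by (simp add: if_distrib cong: if_cong)
  finally show ?thesis .
qed

lemma P_c_til: "i < n \<Longrightarrow> (\<Sum>j<n. P $$ (i, j) * c_til D j) = C_entry D i"
  by (rule sum_PQ) (simp_all add: c_til_eq)

lemma P_e_til: "i < n \<Longrightarrow> (\<Sum>j<n. P $$ (i, j) * e_til D j) = E_entry D i"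
  by (rule sum_PQ) (simp_all add: e_til_eq)

lemma P_injective:
  assumes "\<And>i. i < n \<Longrightarrow> (\<Sum>j<n. P $$ (i, j) * v j) = 0" "j < n"
  shows "v j = 0"
proof -
  have QP_entry: "(\<Sum>i<n. Q $$ (j, i) * P $$ (i, k)) = (if j = k then 1 else 0)" if "k < n" for k
    using arg_cong[OF QP, of "\<lambda>M. M $$ (j, k)"] P_carrier Q_carrier assms(2) that
    by (simp add: scalar_prod_def atLeast0LessThan del: P_carrier Q_carrier)
  have "v j = (\<Sum>k<n. (\<Sum>i<n. Q $$ (j, i) * P $$ (i, k)) * v k)"
    using assms(2) by (simp add: QP_entry if_distrib if_distribR cong: if_cong)
  also have "\<dots> = (\<Sum>i<n. \<Sum>k<n. Q $$ (j, i) * (P $$ (i, k) * v k))"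
    by (subst sum.swap) (simp add: sum_distrib_right mult.assoc)
  also have "\<dots> = (\<Sum>i<n. Q $$ (j, i) * (\<Sum>k<n. P $$ (i, k) * v k))"
    by (simp add: sum_distrib_left)
  also have "\<dots> = 0" by (simp add: assms(1))
  finally show ?thesis .
qed

text \<open>Multiplying the displacement identity by \<open>Q\<close> on both sides gives
  \<open>X Q - Q X = Q (E^T C - C^T E) Q\<close>. The proof treats one column at a time and applies
  the injective \<open>P\<close> to the difference of the two sides.\<close>

lemma inverse_displacement:
  assumes i: "i < n" and j: "j < n"
  shows "Q $$ (j, i) * (node D j - node D i) = e_til D j * c_til D i - c_til D j * e_til D i"
proof -
  define v where "v = (\<lambda>j. Q $$ (j, i) * (node D j - node D i) - (e_til D j * c_til D i - c_til D j * e_til D i))"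
  have "(\<Sum>j<n. P $$ (k, j) * v j) = 0" if k: "k < n" for k
  proof -
    \<comment> \<open>The factor \<open>node D j - node D i\<close> is split at
      \<open>node D k\<close>: the first part meets the displacement identity, the second
      \<open>P Q = I\<close>.\<close>
    have "(\<Sum>j<n. P $$ (k, j) * v j) =
        (\<Sum>j<n. (P $$ (k, j) * (node D j - node D k)) * Q $$ (j, i))
        + (node D k - node D i) * (\<Sum>j<n. P $$ (k, j) * Q $$ (j, i))
        - (\<Sum>j<n. P $$ (k, j) * e_til D j) * c_til D i + (\<Sum>j<n. P $$ (k, j) * c_til D j) * e_til D i"
      by (simp add: v_def sum_distrib_left sum_distrib_right sum.distrib[symmetric] sum_subtractf[symmetric] algebra_simps)
    also have "(\<Sum>j<n. (P $$ (k, j) * (node D j - node D k)) * Q $$ (j, i)) =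
        (\<Sum>j<n. E_entry D k * (C_entry D j * Q $$ (j, i)) - C_entry D k * (E_entry D j * Q $$ (j, i)))"
      using k by (intro sum.cong refl) (subst displacement, auto simp: algebra_simps)
    also have "\<dots> = E_entry D k * c_til D i - C_entry D k * e_til D i"
      using i by (simp add: sum_subtractf sum_distrib_left c_til_eq e_til_eq)
    finally show ?thesis using k i by (simp add: P_c_til P_e_til PQ_entry)
  qed
  from P_injective[OF this j] show ?thesis by (simp add: v_def)
qed

text \<open>Off the nodes the resolvent is an invertible diagonal matrix, so every entry of
  \<open>Theta\<close> is a sum of simple fractions.\<close>

lemma
  assumes "0 < Im z"
  shows Theta_00: "Theta D z $$ (0, 0) =
      1 + (\<Sum>j<n. of_real (C_entry D j * e_til D j) / (z - of_real (node D j)))"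
    and Theta_01: "Theta D z $$ (0, 1) =
      - (\<Sum>j<n. of_real (C_entry D j * c_til D j) / (z - of_real (node D j)))"
    and Theta_10: "Theta D z $$ (1, 0) =
      (\<Sum>j<n. of_real (E_entry D j * e_til D j) / (z - of_real (node D j)))"
    and Theta_11: "Theta D z $$ (1, 1) =
      1 - (\<Sum>j<n. of_real (E_entry D j * c_til D j) / (z - of_real (node D j)))"
proof -
  define R where "R = mat_diag n (\<lambda>j. 1 / (z - of_real (node D j)))"
  \<comment> \<open>\<open>K\<close> collects all factors to the right of the resolvent:
    \<open>J\<close> exchanges the columns of \<open>[C^T E^T]\<close> up to factors
    \<open>\<i>\<close> and \<open>- \<i>\<close>.\<close>
  define K where "K = Matrix.mat n 2 (\<lambda>(j, b). if b = 0 then \<i> * of_real (e_til D j) else - \<i> * complex_of_real (c_til D j))"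
  have nz: "z - of_real (node D j) \<noteq> 0" for j using assms by (auto simp: complex_eq_iff)
  have zX: "z \<cdot>\<^sub>m 1\<^sub>m n - map_mat of_real (X_mat D) = mat_diag n (\<lambda>j. z - of_real (node D j))"
    by (rule eq_matI) (auto simp: X_mat_def mat_diag_def)
  have R: "mat_inverse (z \<cdot>\<^sub>m 1\<^sub>m n - map_mat of_real (X_mat D)) = Some R"
    unfolding zX R_def using nz by (intro mat_inverse_eqI[of _ n]) auto
  have CE: "CE_mat D = Matrix.mat 2 n (\<lambda>(a, j). if a = 0 then of_real (C_entry D j) else of_real (E_entry D j))"
    by (rule eq_matI)
      (auto simp: CE_mat_def append_rows_def C_row_def E_row_def C_entry_def E_entry_def)
  have adj: "mat_adjoint (CE_mat D) * J_mat =
      Matrix.mat n 2 (\<lambda>(k, b). if b = 0 then \<i> * of_real (E_entry D k) else - \<i> * of_real (C_entry D k))"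
    by (rule eq_matI)
      (auto simp: CE mat_adjoint_def J_mat_def mat_of_rows_def mat_of_rows_list_def scalar_prod_def
        numeral_2_eq_2 less_Suc_eq)
  have K: "map_mat of_real Q * (mat_adjoint (CE_mat D) * J_mat) = K"
    unfolding adj K_def
    using Q_carrier
    by (intro eq_matI)
      (auto simp: scalar_prod_def atLeast0LessThan c_til_eq e_til_eq Q_sym sum_distrib_left
         sum_negf algebra_simps simp del: Q_carrier intro!: sum.cong)
  have car: "CE_mat D \<in> carrier_mat 2 n" "R \<in> carrier_mat n n" "K \<in> carrier_mat n 2"
    "mat_adjoint (CE_mat D) \<in> carrier_mat n 2" "J_mat \<in> carrier_mat 2 2"
    by (auto simp: CE R_def K_def mat_adjoint_def J_mat_def mat_of_rows_list_def)
  have car1: "CE_mat D * R \<in> carrier_mat 2 n"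
    by (rule mult_carrier_mat[OF car(1,2)])
  have car2: "CE_mat D * R * map_mat of_real Q \<in> carrier_mat 2 n"
    by (rule mult_carrier_mat[OF car1]) simp
  have "CE_mat D * R * map_mat of_real Q * mat_adjoint (CE_mat D) * J_mat
      = CE_mat D * R * map_mat of_real Q * (mat_adjoint (CE_mat D) * J_mat)"
    by (rule assoc_mult_mat[OF car2 car(4,5)])
  also have "\<dots> = CE_mat D * R * K"
    unfolding K[symmetric] by (rule assoc_mult_mat[OF car1 _ mult_carrier_mat[OF car(4,5)]]) simp
  finally have Th: "Theta D z = 1\<^sub>m 2 - \<i> \<cdot>\<^sub>m (CE_mat D * R * K)"
    unfolding Theta_def R by simp
  have CER: "CE_mat D * R = Matrix.mat 2 n (\<lambda>(a, j). CE_mat D $$ (a, j) * (1 / (z - of_real (node D j))))"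
    unfolding R_def by (rule mat_diag_mult_right[OF car(1)])
  have entry: "(CE_mat D * R * K) $$ (a, b) =
     (\<Sum>j<n. CE_mat D $$ (a, j) * (1 / (z - of_real (node D j))) * K $$ (j, b))" if "a < 2" "b < 2" for a b
    using that car unfolding CER by (simp add: scalar_prod_def atLeast0LessThan)
  have Th': "Theta D z $$ (a, b) = (if a = b then 1 else 0) - \<i> *
     (\<Sum>j<n. CE_mat D $$ (a, j) * (1 / (z - of_real (node D j))) * K $$ (j, b))" if "a < 2" "b < 2" for a b
    using that car entry[OF that] unfolding Th by simp
  have ii: "\<i> * (a * (\<i> * b)) = - (a * b)" for a b by (metis complex_i_mult_minus mult.left_commute mult_minus_right)
  show "Theta D z $$ (0, 0) =
      1 + (\<Sum>j<n. of_real (C_entry D j * e_til D j) / (z - of_real (node D j)))"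
  proof -
    have "Theta D z $$ (0, 0) =
        1 - - (\<Sum>j<n. of_real (C_entry D j * e_til D j) / (z - of_real (node D j)))"
      by (subst Th') (auto simp: CE K_def sum_distrib_left sum_negf[symmetric] ii intro!: sum.cong)
    thus ?thesis by simp
  qed
  show "Theta D z $$ (0, 1) =
      - (\<Sum>j<n. of_real (C_entry D j * c_til D j) / (z - of_real (node D j)))"
    by (subst Th') (auto simp: CE K_def sum_distrib_left sum_negf[symmetric] ii intro!: sum.cong)
  show "Theta D z $$ (1, 0) =
      (\<Sum>j<n. of_real (E_entry D j * e_til D j) / (z - of_real (node D j)))"
    by (subst Th') (auto simp: CE K_def sum_distrib_left sum_negf[symmetric] ii intro!: sum.cong)
  show "Theta D z $$ (1, 1) =
      1 - (\<Sum>j<n. of_real (E_entry D j * c_til D j) / (z - of_real (node D j)))"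
    by (subst Th') (auto simp: CE K_def sum_distrib_left sum_negf[symmetric] ii intro!: sum.cong)
qed

end

subsection \<open>Boundary behaviour at a singular node\<close>

locale singular_node = invertible_pick +
  fixes i :: nat
  assumes singular: "num_regular D \<le> i" and less: "i < num_nodes D"
    and e_til_0: "e_til D i = 0"
begin

abbreviation "x \<equiv> node D i"
abbreviation "\<xi> \<equiv> xi D i"
abbreviation "c \<equiv> c_til D i"
abbreviation "p \<equiv> p_til D i"
abbreviation "S \<equiv> {..<n} - {i}"

section \<open>Identities from row and column \<open>i\<close> of the Pick matrix and its
  inverse\<close>

lemma xi_nonzero: "\<xi> \<noteq> 0"
  using ok singular less by (simp add: pick_data_ok_def)

lemma sum_split: "(\<Sum>j<n. f j) = f i + sum f S" for f :: "nat \<Rightarrow> 'a :: comm_monoid_add"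
  using less by (intro sum.remove) auto

lemma C_entry_i: "C_entry D i = \<xi>" and E_entry_i: "E_entry D i = 0"
  using singular by (simp_all add: C_entry_def E_entry_def)

lemma node_diff: "j \<in> S \<Longrightarrow> node D j - x \<noteq> 0" "j \<in> S \<Longrightarrow> x - node D j \<noteq> 0"
  using node_neq[of i j] less by auto

text \<open>As \<open>e_til D i = 0\<close>, one term of \<open>inverse_displacement\<close> drops
  out, and sums against this column become sums of simple fractions at \<open>x\<close>.\<close>

lemma Q_column: "j \<in> S \<Longrightarrow> Q $$ (j, i) = - (e_til D j * c / (x - node D j))"
  using inverse_displacement[of i j] node_diff[of j] less e_til_0
  by (simp add: field_simps)

text \<open>\<open>c\<close> is expanded along column \<open>i\<close> of \<open>Q\<close>; the sum
  that arises is the one in the (0, 0) entry of \<open>Theta\<close> at \<open>x\<close>.\<close>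

lemma c_til_expand: "c = \<xi> * p - c * (\<Sum>j\<in>S. C_entry D j * e_til D j / (x - node D j))"
proof -
  have "c = \<xi> * p + (\<Sum>j\<in>S. C_entry D j * Q $$ (j, i))"
    using less by (subst c_til_eq) (simp_all add: sum_split C_entry_i p_til_def)
  also have "(\<Sum>j\<in>S. C_entry D j * Q $$ (j, i)) = (\<Sum>j\<in>S. - (c * (C_entry D j * e_til D j / (x - node D j))))"
    by (intro sum.cong refl) (simp add: Q_column)
  finally show ?thesis by (simp add: sum_negf sum_distrib_left)
qed

text \<open>A singular row of \<open>P\<close> acts as a Cauchy kernel, so pairing with it evaluates
  simple fractions at \<open>x\<close>. It is applied to \<open>e_til\<close>, \<open>c_til\<close>
  and column \<open>i\<close> of \<open>Q\<close>.\<close>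

lemma sum_P_row: "(\<Sum>j<n. P $$ (i, j) * f j) = \<xi> * ((\<Sum>j\<in>S. E_entry D j * f j / (x - node D j)) - f i)"
proof -
  have "(\<Sum>j<n. P $$ (i, j) * f j) = P $$ (i, i) * f i + (\<Sum>j\<in>S. P $$ (i, j) * f j)"
    by (rule sum_split)
  also have "(\<Sum>j\<in>S. P $$ (i, j) * f j) = (\<Sum>j\<in>S. \<xi> * (E_entry D j * f j / (x - node D j)))"
    using singular less by (intro sum.cong refl) (auto simp: P_row_singular)
  finally show ?thesis using singular less
    by (simp add: P_row_singular sum_distrib_left algebra_simps)
qed

text \<open>The (1, 0) entry of \<open>Theta\<close> thus vanishes at \<open>x\<close>, which makes
  its division by \<open>z - x\<close> harmless.\<close>

lemma sum_E_e_til: "(\<Sum>j\<in>S. E_entry D j * e_til D j / (x - node D j)) = 0"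
  using P_e_til[OF less] xi_nonzero by (simp add: sum_P_row E_entry_i e_til_0)

lemma sum_E_c_til: "(\<Sum>j\<in>S. E_entry D j * c_til D j / (x - node D j)) = 1 + c"
proof -
  have "\<xi> * ((\<Sum>j\<in>S. E_entry D j * c_til D j / (x - node D j)) - c) = \<xi>"
    using P_c_til[OF less] unfolding sum_P_row C_entry_i .
  hence "(\<Sum>j\<in>S. E_entry D j * c_til D j / (x - node D j)) - c = 1" using xi_nonzero by simp
  thus ?thesis by simp
qed

text \<open>The sum is, up to sign, the derivative of the (1, 0) entry at \<open>x\<close>; its
  value comes from the diagonal entry \<open>i\<close> of \<open>P Q = I\<close>.\<close>

lemma sum_E_e_til_deriv:
  "- \<xi> * c * (\<Sum>j\<in>S. E_entry D j * e_til D j / (x - node D j)\<^sup>2) = 1 + \<xi> * p"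
proof -
  have "\<xi> * ((\<Sum>j\<in>S. E_entry D j * Q $$ (j, i) / (x - node D j)) - p) = 1"
    using PQ_entry[OF less less] by (simp add: sum_P_row p_til_def)
  moreover have "(\<Sum>j\<in>S. E_entry D j * Q $$ (j, i) / (x - node D j))
      = (\<Sum>j\<in>S. - (c * (E_entry D j * e_til D j / (x - node D j)\<^sup>2)))"
    by (intro sum.cong refl) (simp add: Q_column power2_eq_square)
  ultimately show ?thesis by (simp add: sum_negf sum_distrib_left algebra_simps)
qed

text \<open>For \<open>c = 0\<close> the two expansions would force \<open>\<xi> * p\<close> to be
  both 0 and -1.\<close>

lemma c_til_nonzero: "c \<noteq> 0"
proof
  assume "c = 0"
  hence "0 = \<xi> * p" "0 = 1 + \<xi> * p"
    using c_til_expand sum_E_e_til_deriv by (simp_all only: mult_zero_left mult_zero_right diff_0_right)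
  thus False by linarith
qed

section \<open>Limits of the four coefficients at the node\<close>

lemma eventually_Im_pos: "eventually (\<lambda>z. 0 < Im z \<and> z - of_real x \<noteq> 0) (at (of_real x) within stolz_cone x a)"
  using eventually_stolz_cone[of x a] by eventually_elim auto

lemma node_diff_complex: "j \<in> S \<Longrightarrow> complex_of_real x - of_real (node D j) \<noteq> 0"
  using node_diff[of j] by (metis of_real_diff of_real_eq_0_iff)

text \<open>There is no pole at \<open>x\<close> because its residue contains
  \<open>e_til D i\<close>.\<close>

lemma tendsto_Theta_00:
  "((\<lambda>z. Theta D z $$ (0, 0)) \<longlongrightarrow> of_real (\<xi> * p / c)) (at (of_real x) within stolz_cone x a)"
proof -
  have "((\<lambda>z. 1 + (\<Sum>j\<in>S. of_real (C_entry D j * e_til D j) / (z - of_real (node D j)))) \<longlongrightarrow>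
      1 + (\<Sum>j\<in>S. of_real (C_entry D j * e_til D j) / (of_real x - of_real (node D j))))
      (at (of_real x) within stolz_cone x a)"
    by (intro tendsto_intros node_diff_complex)
  moreover have "1 + (\<Sum>j\<in>S. complex_of_real (C_entry D j * e_til D j) / (of_real x - of_real (node D j)))
      = of_real (1 + (\<Sum>j\<in>S. C_entry D j * e_til D j / (x - node D j)))"
    by simp
  moreover have "1 + (\<Sum>j\<in>S. C_entry D j * e_til D j / (x - node D j)) = \<xi> * p / c"
    using c_til_expand c_til_nonzero by (simp add: field_simps)
  moreover have "eventually (\<lambda>z. 1 + (\<Sum>j\<in>S. of_real (C_entry D j * e_til D j) / (z - of_real (node D j)))
      = Theta D z $$ (0, 0)) (at (of_real x) within stolz_cone x a)"
    using eventually_Im_pos[of a] by eventually_elim (simp add: Theta_00 sum_split e_til_0)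
  ultimately show ?thesis by (auto elim: Lim_transform_eventually)
qed

text \<open>Here the simple pole survives, and the factor \<open>z - x\<close> extracts its
  residue.\<close>

lemma tendsto_Theta_01:
  "((\<lambda>z. (z - of_real x) * Theta D z $$ (0, 1)) \<longlongrightarrow> of_real (- (\<xi> * c))) (at (of_real x) within stolz_cone x a)"
proof (rule Lim_transform_eventually)
  show "((\<lambda>z. - (of_real (\<xi> * c) +
      (z - of_real x) * (\<Sum>j\<in>S. of_real (C_entry D j * c_til D j) / (z - of_real (node D j)))))
      \<longlongrightarrow> of_real (- (\<xi> * c))) (at (of_real x) within stolz_cone x a)"
    by (rule tendsto_eq_intros node_diff_complex refl | assumption)+ simp
  show "eventually (\<lambda>z. - (of_real (\<xi> * c) +
      (z - of_real x) * (\<Sum>j\<in>S. of_real (C_entry D j * c_til D j) / (z - of_real (node D j))))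
      = (z - of_real x) * Theta D z $$ (0, 1)) (at (of_real x) within stolz_cone x a)"
    using eventually_Im_pos[of a]
  proof eventually_elim
    case (elim z)
    have *: "- (b + u * s) = u * - (b / u + s)" if "u \<noteq> 0" for b u s :: complex
      using that by (simp add: field_simps)
    have "0 < Im z" using elim by simp
    show ?case
      unfolding Theta_01[OF \<open>0 < Im z\<close>] sum_split C_entry_i using elim by (intro *) simp
  qed
qed

lemma tendsto_Theta_10:
  "((\<lambda>z. Theta D z $$ (1, 0) / (z - of_real x)) \<longlongrightarrow> of_real ((1 + \<xi> * p) / (\<xi> * c)))
     (at (of_real x) within stolz_cone x a)"
proof -
  \<comment> \<open>From \<open>1 / (z - x_j) - 1 / (x - x_j) = - (z - x) / ((z - x_j) (x -
    x_j))\<close>: the negated sum of \<open>?h\<close> is a difference quotient at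
    \<open>x\<close>.\<close>
  let ?h = "\<lambda>z j. of_real (E_entry D j * e_til D j) / ((z - of_real (node D j)) * (of_real x - of_real (node D j)))"
  have "((\<lambda>z. - (\<Sum>j\<in>S. ?h z j)) \<longlongrightarrow> - (\<Sum>j\<in>S. ?h (complex_of_real x) j))
      (at (of_real x) within stolz_cone x a)"
    by (intro tendsto_intros mult_nonneg_nonneg no_zero_divisors node_diff_complex)
  moreover have "- (\<Sum>j\<in>S. ?h (complex_of_real x) j)
      = of_real (- (\<Sum>j\<in>S. E_entry D j * e_til D j / (x - node D j)\<^sup>2))"
    by (simp add: power2_eq_square)
  moreover have "- (\<Sum>j\<in>S. E_entry D j * e_til D j / (x - node D j)\<^sup>2) = (1 + \<xi> * p) / (\<xi> * c)"
    using sum_E_e_til_deriv c_til_nonzero xi_nonzero by (simp add: field_simps)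
  moreover have "eventually (\<lambda>z. - (\<Sum>j\<in>S. ?h z j) = Theta D z $$ (1, 0) / (z - of_real x))
      (at (of_real x) within stolz_cone x a)"
    using eventually_Im_pos[of a]
  proof eventually_elim
    case (elim z)
    have "(\<Sum>j\<in>S. complex_of_real (E_entry D j * e_til D j) / (of_real x - of_real (node D j)))
       = of_real (\<Sum>j\<in>S. E_entry D j * e_til D j / (x - node D j))" by simp
    hence 0: "(\<Sum>j\<in>S. complex_of_real (E_entry D j * e_til D j) / (of_real x - of_real (node D j))) = 0"
      unfolding sum_E_e_til by simp
    \<comment> \<open>The subtracted sum is the value at \<open>x\<close>, which is 0.\<close>
    have "Theta D z $$ (1, 0) = (\<Sum>j\<in>S. of_real (E_entry D j * e_til D j) / (z - of_real (node D j)))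
       - (\<Sum>j\<in>S. of_real (E_entry D j * e_til D j) / (of_real x - of_real (node D j)))"
      unfolding 0 using elim by (simp add: Theta_10 sum_split e_til_0 del: One_nat_def)
    also have "\<dots> = (\<Sum>j\<in>S. - (z - of_real x) * ?h z j)"
      unfolding sum_subtractf[symmetric]
    proof (intro sum.cong refl)
      fix j assume j: "j \<in> S"
      have "z - of_real (node D j) \<noteq> 0" using elim by (auto simp: complex_eq_iff)
      thus "of_real (E_entry D j * e_til D j) / (z - of_real (node D j))
          - of_real (E_entry D j * e_til D j) / (of_real x - of_real (node D j)) = - (z - of_real x) * ?h z j"
        using node_diff_complex[OF j] by (simp add: diff_frac_eq del: of_real_mult) (simp add: algebra_simps)
    qed
    also have "\<dots> = - (z - of_real x) * (\<Sum>j\<in>S. ?h z j)" by (simp only: sum_distrib_left)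
    finally have eq: "Theta D z $$ (1, 0) = - (z - of_real x) * (\<Sum>j\<in>S. ?h z j)" .
    show ?case
      unfolding eq using elim
      by (simp only: mult_minus_left minus_divide_left[symmetric] nonzero_mult_div_cancel_left not_False_eq_True)
  qed
  ultimately show ?thesis by (auto elim: Lim_transform_eventually)
qed

text \<open>There is no pole at \<open>x\<close> because \<open>E_entry D i = 0\<close>.\<close>

lemma tendsto_Theta_11:
  "((\<lambda>z. Theta D z $$ (1, 1)) \<longlongrightarrow> of_real (- c)) (at (of_real x) within stolz_cone x a)"
proof -
  have "((\<lambda>z. 1 - (\<Sum>j\<in>S. of_real (E_entry D j * c_til D j) / (z - of_real (node D j)))) \<longlongrightarrow>
      1 - (\<Sum>j\<in>S. of_real (E_entry D j * c_til D j) / (of_real x - of_real (node D j))))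
      (at (of_real x) within stolz_cone x a)"
    by (intro tendsto_intros node_diff_complex)
  moreover have "1 - (\<Sum>j\<in>S. complex_of_real (E_entry D j * c_til D j) / (of_real x - of_real (node D j)))
      = of_real (1 - (\<Sum>j\<in>S. E_entry D j * c_til D j / (x - node D j)))"
    by simp
  moreover have "1 - (\<Sum>j\<in>S. E_entry D j * c_til D j / (x - node D j)) = - c"
    using sum_E_c_til by simp
  moreover have "eventually (\<lambda>z. 1 - (\<Sum>j\<in>S. of_real (E_entry D j * c_til D j) / (z - of_real (node D j)))
      = Theta D z $$ (1, 1)) (at (of_real x) within stolz_cone x a)"
    using eventually_Im_pos[of a] by eventually_elim (simp add: Theta_11 sum_split E_entry_i del: One_nat_def)
  ultimately show ?thesis by (auto elim: Lim_transform_eventually)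
qed

lemma ntlim_m1_T_Theta_finite:
  assumes f: "\<And>z. 0 < Im z \<Longrightarrow> \<phi> z = Some (f z)"
    and lim: "\<And>a. 0 < a \<Longrightarrow> ((\<lambda>z. (z - of_real x) * f z) \<longlongrightarrow> of_real (- \<kappa>)) (at (of_real x) within stolz_cone x a)"
  shows "ntlim_m1 (T_Theta D \<phi>) x
    (sphere_divide (of_real (\<xi> * p / c * (- \<kappa>) + - (\<xi> * c))) (of_real ((1 + \<xi> * p) / (\<xi> * c) * (- \<kappa>) + - c)))"
    (is "ntlim_m1 _ _ (sphere_divide (of_real ?num) (of_real ?den))")
  unfolding ntlim_m1_def ntlim_def
proof (intro allI impI)
  fix a :: real assume a: "0 < a"
  let ?F = "at (of_real x) within stolz_cone x a"
  let ?\<psi> = "\<lambda>z. (z - of_real x) * f z"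
  have num: "((\<lambda>z. Theta D z $$ (0, 0) * ?\<psi> z + (z - of_real x) * Theta D z $$ (0, 1)) \<longlongrightarrow> of_real ?num) ?F"
    unfolding of_real_add of_real_mult[of _ "- \<kappa>"]
    by (intro tendsto_add tendsto_mult[OF tendsto_Theta_00] tendsto_Theta_01 lim a)
  have den: "((\<lambda>z. Theta D z $$ (1, 0) / (z - of_real x) * ?\<psi> z + Theta D z $$ (1, 1)) \<longlongrightarrow> of_real ?den) ?F"
    unfolding of_real_add of_real_mult[of _ "- \<kappa>"]
    by (intro tendsto_add tendsto_mult[OF tendsto_Theta_10] tendsto_Theta_11 lim a)
  \<comment> \<open>This combination eliminates \<open>\<kappa>\<close> and leaves the determinant
    of the limit matrix, so 0/0 cannot occur.\<close>
  have "(\<xi> * p / c) * ?den - ((1 + \<xi> * p) / (\<xi> * c)) * ?num = 1"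
    using xi_nonzero c_til_nonzero by (simp add: field_simps)
  hence "?num \<noteq> 0 \<or> ?den \<noteq> 0" by (metis diff_self mult_zero_right zero_neq_one)
  hence nz: "complex_of_real ?num \<noteq> 0 \<or> complex_of_real ?den \<noteq> 0" by (metis of_real_eq_0_iff)
  show "limitin riemann_sphere (\<lambda>z. map_option (\<lambda>c. (z - of_real x) * c) (T_Theta D \<phi> z))
      (sphere_divide (of_real ?num) (of_real ?den)) ?F"
  proof (rule limitin_transform_eventually[OF _ limitin_sphere_divide[OF num den nz]])
    show "\<forall>\<^sub>F z in ?F. sphere_divide (Theta D z $$ (0, 0) * ?\<psi> z + (z - of_real x) * Theta D z $$ (0, 1))
        (Theta D z $$ (1, 0) / (z - of_real x) * ?\<psi> z + Theta D z $$ (1, 1)) =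
        map_option (\<lambda>c. (z - of_real x) * c) (T_Theta D \<phi> z)"
      using eventually_Im_pos[of a]
    proof eventually_elim
      case (elim z)
      have "Theta D z $$ (0, 0) * ?\<psi> z + (z - of_real x) * Theta D z $$ (0, 1)
          = (z - of_real x) * (Theta D z $$ (0, 0) * f z + Theta D z $$ (0, 1))"
        by (simp only: distrib_left mult_ac)
      moreover have "t / u * (u * y) = t * y" if "u \<noteq> 0" for t u y :: complex
        using that by simp
      hence "Theta D z $$ (1, 0) / (z - of_real x) * ?\<psi> z = Theta D z $$ (1, 0) * f z"
        using elim by blast
      ultimately show ?case
        using elim by (simp add: T_Theta_def f sphere_divide_def del: One_nat_def)
    qed
  qed
qed

lemma ntlim_m1_T_Theta_infinity:
  assumes "\<And>z. 0 < Im z \<Longrightarrow> \<phi> z = None"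
  shows "ntlim_m1 (T_Theta D \<phi>) x (sphere_divide (of_real (\<xi> * p / c)) (of_real ((1 + \<xi> * p) / (\<xi> * c))))"
    (is "ntlim_m1 _ _ (sphere_divide (of_real ?num) (of_real ?den))")
  unfolding ntlim_m1_def ntlim_def
proof (intro allI impI)
  fix a :: real assume a: "0 < a"
  let ?F = "at (of_real x) within stolz_cone x a"
  \<comment> \<open>\<open>\<xi> * p\<close> and \<open>1 + \<xi> * p\<close> cannot both
    vanish.\<close>
  have "?num \<noteq> 0 \<or> ?den \<noteq> 0"
    using xi_nonzero c_til_nonzero by auto
  hence nz: "complex_of_real ?num \<noteq> 0 \<or> complex_of_real ?den \<noteq> 0" by (metis of_real_eq_0_iff)
  show "limitin riemann_sphere (\<lambda>z. map_option (\<lambda>c. (z - of_real x) * c) (T_Theta D \<phi> z))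
      (sphere_divide (of_real ?num) (of_real ?den)) ?F"
  proof (rule limitin_transform_eventually[OF _ limitin_sphere_divide[OF tendsto_Theta_00 tendsto_Theta_10 nz]])
    show "\<forall>\<^sub>F z in ?F. sphere_divide (Theta D z $$ (0, 0)) (Theta D z $$ (1, 0) / (z - of_real x)) =
        map_option (\<lambda>c. (z - of_real x) * c) (T_Theta D \<phi> z)"
      using eventually_Im_pos[of a]
      by eventually_elim (simp add: T_Theta_def assms sphere_divide_def del: One_nat_def)
  qed
qed

text \<open>The pair \<open>(\<alpha>, \<beta>)\<close> gives the projective coordinates of \<open>\<phi>\<^sub>-\<^sub>1(x)\<close>, so that
  the case of the function identically infinity needs no separate treatment.\<close>

lemma boundary_coordinates:
  assumes "\<phi> \<in> nevanlinna_ext"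
  obtains \<alpha> \<beta> :: real where "\<beta> = 1 \<and> \<alpha> \<le> 0 \<or> \<beta> = 0 \<and> \<alpha> = 1"
    "ntlim_m1 \<phi> x (sphere_divide (of_real \<alpha>) (of_real \<beta>))"
    "ntlim_m1 (T_Theta D \<phi>) x (sphere_divide (of_real (\<xi> * p / c * \<alpha> - \<xi> * c * \<beta>))
       (of_real ((1 + \<xi> * p) / (\<xi> * c) * \<alpha> - c * \<beta>)))"
    "\<alpha> \<noteq> 0 \<Longrightarrow> ntlim \<phi> x None"
proof -
  consider "\<phi> \<in> nevanlinna" | "\<And>z. 0 < Im z \<Longrightarrow> \<phi> z = None"
    using assms by (auto simp: nevanlinna_ext_def upper_half_plane_def)
  thus thesis
  proof cases
    case 1
    then obtain f where f: "f analytic_on upper_half_plane" "\<And>z. 0 < Im z \<Longrightarrow> 0 \<le> Im (f z)"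
      "\<And>z. 0 < Im z \<Longrightarrow> \<phi> z = Some (f z)"
      by (auto simp: nevanlinna_def upper_half_plane_def)
    obtain \<kappa> :: real where \<kappa>: "0 \<le> \<kappa>" "\<And>a. 0 < a \<Longrightarrow>
       ((\<lambda>z. (z - of_real x) * f z) \<longlongrightarrow> of_real (- \<kappa>)) (at (of_real x) within stolz_cone x a)"
      using Julia_Caratheodory_upper_half_plane[OF analytic_imp_holomorphic[OF f(1)] f(2)] by metis
    show thesis
    \<comment> \<open>The instantiation is in the order \<open>\<beta>\<close>,
      \<open>\<alpha>\<close>.\<close>
    proof (rule that[of 1 "- \<kappa>"])
      show "ntlim_m1 \<phi> x (sphere_divide (of_real (- \<kappa>)) (of_real 1))"
        unfolding ntlim_m1_def ntlim_def
        using limitin_riemann_sphere_Some[OF \<kappa>(2) eventually_at_stolz_cone] f(3)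
        by (simp add: sphere_divide_def)
      show "- \<kappa> \<noteq> 0 \<Longrightarrow> ntlim \<phi> x None"
        using ntlim_infinity[OF f(3) _ \<kappa>(2)] by simp
    qed (use \<kappa>(1) ntlim_m1_T_Theta_finite[OF f(3) \<kappa>(2)] in simp_all)
  next
    case 2
    have none: "limitin riemann_sphere h None (at (of_real x) within stolz_cone x a)"
      if "\<And>z. 0 < Im z \<Longrightarrow> h z = None" for h a
      by (rule limitin_riemann_sphere_None, rule eventually_at_stolz_cone) (simp add: that)
    show thesis
    proof (rule that[of 0 1])
      show "ntlim_m1 \<phi> x (sphere_divide (of_real 1) (of_real 0))" "ntlim \<phi> x None"
        unfolding ntlim_m1_def ntlim_def by (auto intro!: none simp: 2 sphere_divide_def)
    qed (use ntlim_m1_T_Theta_infinity[OF 2] in simp_all)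
  qed
qed

text \<open>With \<open>q\<close> as below, \<open>1 / w_{-1} - 1 / \<xi>\<close> is
  \<open>\<alpha> / (\<xi>^2 q)\<close>, while \<open>p / c^2 - 1 / \<phi>_{-1}\<close> is
  \<open>q / (c^2 \<alpha>)\<close>. So the vanishing and the relative sign of
  \<open>\<alpha>\<close> and \<open>q\<close> decide all four cases.\<close>

lemma boundary_classification:
  assumes "\<phi> \<in> nevanlinna_ext" and w: "w = T_Theta D \<phi>"
  shows "ntlim_m1 w x (Some (of_real \<xi>)) \<longleftrightarrow> cond_C1 D \<phi> i \<or> cond_C2 D \<phi> i"
    and "(\<exists>t. inv_m1 w x t \<and> - t < - inverse \<xi>) \<longleftrightarrow> cond_C3 D \<phi> i"
    and "(\<exists>t. inv_m1 w x t \<and> - inverse \<xi> < - t) \<longleftrightarrow> cond_C4 D \<phi> i"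
    and "ntlim_m1 w x (Some 0) \<longleftrightarrow> cond_C5 D \<phi> i \<or> cond_C6 D \<phi> i"
proof -
  obtain \<alpha> \<beta> :: real where ab: "\<beta> = 1 \<and> \<alpha> \<le> 0 \<or> \<beta> = 0 \<and> \<alpha> = 1"
    and lim\<phi>: "ntlim_m1 \<phi> x (sphere_divide (of_real \<alpha>) (of_real \<beta>))"
    and limw: "ntlim_m1 w x (sphere_divide (of_real (\<xi> * p / c * \<alpha> - \<xi> * c * \<beta>))
       (of_real ((1 + \<xi> * p) / (\<xi> * c) * \<alpha> - c * \<beta>)))"
    and inf: "\<alpha> \<noteq> 0 \<Longrightarrow> ntlim \<phi> x None"
    using boundary_coordinates[OF assms(1)] unfolding w by metis
  note nz = xi_nonzero c_til_nonzero
  define q where "q = p * \<alpha> - c\<^sup>2 * \<beta>"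
  have num: "\<xi> * p / c * \<alpha> - \<xi> * c * \<beta> = \<xi> / c * q"
    using nz by (simp add: q_def field_simps power2_eq_square)
  have den: "(1 + \<xi> * p) / (\<xi> * c) * \<alpha> - c * \<beta> = (\<alpha> + \<xi> * q) / (\<xi> * c)"
    using nz by (simp add: q_def field_simps power2_eq_square)
  note limw = limw[unfolded num den]
  \<comment> \<open>If \<open>\<alpha> = 0\<close>, then \<open>\<beta> = 1\<close> and
    \<open>q = - c^2\<close>.\<close>
  have q0: "\<alpha> \<noteq> 0 \<or> q \<noteq> 0" using ab nz by (auto simp: q_def)
  have inv\<phi>: "inv_m1 \<phi> x t \<longleftrightarrow> \<alpha> \<noteq> 0 \<and> t = \<beta> / \<alpha>" for t
    using ab by (intro inv_m1_ratio_iff[OF lim\<phi>]) auto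
  have invw: "inv_m1 w x t \<longleftrightarrow> q \<noteq> 0 \<and> t = inverse \<xi> + \<alpha> / (\<xi>\<^sup>2 * q)" for t
  proof -
    have "\<xi> / c * q \<noteq> 0 \<or> (\<alpha> + \<xi> * q) / (\<xi> * c) \<noteq> 0" using q0 nz by auto
    from inv_m1_ratio_iff[OF limw this]
    have "inv_m1 w x t \<longleftrightarrow> q \<noteq> 0 \<and> t = (\<alpha> + \<xi> * q) / (\<xi> * c) / (\<xi> / c * q)" using nz by simp
    moreover have "(\<alpha> + \<xi> * q) / (\<xi> * c) / (\<xi> / c * q) = inverse \<xi> + \<alpha> / (\<xi>\<^sup>2 * q)" if "q \<noteq> 0"
      using nz that by (simp add: field_simps power2_eq_square)
    ultimately show ?thesis by auto
  qed
  have diff: "p / c\<^sup>2 - \<beta> / \<alpha> = q / (c\<^sup>2 * \<alpha>)" if "\<alpha> \<noteq> 0"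
    using that nz by (simp add: q_def field_simps)
  \<comment> \<open>Both quotients have the sign of \<open>\<alpha> * q\<close>.\<close>
  have sign: "0 < q / (c\<^sup>2 * \<alpha>) \<longleftrightarrow> 0 < \<alpha> / (\<xi>\<^sup>2 * q)" "q / (c\<^sup>2 * \<alpha>) < 0 \<longleftrightarrow> \<alpha> / (\<xi>\<^sup>2 * q) < 0"
    using nz by (auto simp: zero_less_divide_iff divide_less_0_iff zero_less_mult_iff mult_less_0_iff)
  have gap: "- p / c\<^sup>2 < - (\<beta> / \<alpha>) \<longleftrightarrow> 0 < q / (c\<^sup>2 * \<alpha>)"
    "- (\<beta> / \<alpha>) < - p / c\<^sup>2 \<longleftrightarrow> q / (c\<^sup>2 * \<alpha>) < 0" if "\<alpha> \<noteq> 0"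
    unfolding diff[OF that, symmetric] by auto
  have \<beta>\<alpha>: "\<beta> / \<alpha> \<le> 0" using ab by (auto simp: divide_nonneg_nonpos)
  show "ntlim_m1 w x (Some (of_real \<xi>)) \<longleftrightarrow> cond_C1 D \<phi> i \<or> cond_C2 D \<phi> i"
  proof -
    have "ntlim_m1 w x (Some (of_real \<xi>)) \<longleftrightarrow> \<alpha> = 0"
      unfolding ntlim_m1_ratio_iff[OF limw] using nz q0 by (auto simp: field_simps)
    also have "\<dots> \<longleftrightarrow> ntlim_m1 \<phi> x (Some (of_real 0))"
      unfolding ntlim_m1_ratio_iff[OF lim\<phi>] using ab by auto
    \<comment> \<open>For \<open>\<alpha> = 0\<close>, \<open>\<phi>_{-1}\<close> is 0, and C1 or C2
      holds according to whether \<open>\<phi>\<close> tends to infinity; for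
      \<open>\<alpha> \<noteq> 0\<close> both fail.\<close>
    finally show ?thesis
      using inf ntlim_m1_ratio_iff[OF lim\<phi>, of 0] ab by (auto simp: cond_C1_def cond_C2_def)
  qed
  show "(\<exists>t. inv_m1 w x t \<and> - t < - inverse \<xi>) \<longleftrightarrow> cond_C3 D \<phi> i"
  proof -
    \<comment> \<open>Division by zero yields 0, so the strict inequality also records
      \<open>q \<noteq> 0\<close>.\<close>
    have "(\<exists>t. inv_m1 w x t \<and> - t < - inverse \<xi>) \<longleftrightarrow> 0 < \<alpha> / (\<xi>\<^sup>2 * q)"
      unfolding invw by auto
    also have "\<dots> \<longleftrightarrow> \<alpha> \<noteq> 0 \<and> - p / c\<^sup>2 < - (\<beta> / \<alpha>)"
      using gap(1) sign(1) by (metis divide_eq_0_iff order_less_irrefl)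
    finally show ?thesis using inf by (auto simp: cond_C3_def inv\<phi>)
  qed
  show "(\<exists>t. inv_m1 w x t \<and> - inverse \<xi> < - t) \<longleftrightarrow> cond_C4 D \<phi> i"
  proof -
    have "(\<exists>t. inv_m1 w x t \<and> - inverse \<xi> < - t) \<longleftrightarrow> \<alpha> / (\<xi>\<^sup>2 * q) < 0"
      unfolding invw by auto
    also have "\<dots> \<longleftrightarrow> \<alpha> \<noteq> 0 \<and> - (\<beta> / \<alpha>) < - p / c\<^sup>2"
      using gap(2) sign(2) by (metis divide_eq_0_iff order_less_irrefl)
    \<comment> \<open>\<open>\<beta> / \<alpha> \<le> 0\<close> supplies the lower bound
      \<open>0 \<le> - t\<close> in C4.\<close>
    finally show ?thesis using inf \<beta>\<alpha> by (auto simp: cond_C4_def inv\<phi>)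
  qed
  show "ntlim_m1 w x (Some 0) \<longleftrightarrow> cond_C5 D \<phi> i \<or> cond_C6 D \<phi> i"
  proof -
    have "ntlim_m1 w x (Some 0) \<longleftrightarrow> q = 0"
      using ntlim_m1_ratio_iff[OF limw, of 0] nz q0 by auto
    also have "\<dots> \<longleftrightarrow> \<alpha> \<noteq> 0 \<and> \<beta> / \<alpha> = p / c\<^sup>2"
      using q0 diff nz by auto
    also have "\<dots> \<longleftrightarrow> cond_C5 D \<phi> i \<or> cond_C6 D \<phi> i"
    proof -
      \<comment> \<open>The common value is at most 0: negative gives C5, zero gives
        \<open>p = 0\<close> and C6.\<close>
      have "p / c\<^sup>2 < 0 \<or> p = 0" if "\<beta> / \<alpha> = p / c\<^sup>2"
        using that \<beta>\<alpha> nz by (metis divide_eq_0_iff order_le_less power2_eq_square mult_eq_0_iff)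
      thus ?thesis using inf by (auto simp: cond_C5_def cond_C6_def inv\<phi>)
    qed
    finally show ?thesis .
  qed
qed

end

theorem theorem2p5:
  fixes D :: pick_data
    and \<phi> w :: "complex \<Rightarrow> complex option"
    and i :: "nat"
  assumes "pick_data_ok D"
    and "invertible_mat (pick_matrix D)"
    and "\<phi> \<in> nevanlinna_ext"
    and "w = T_Theta D \<phi>"
    and "num_regular D \<le> i" and "i < num_nodes D"
    and "e_til D i = 0"
  shows
    "(ntlim_m1 w (node D i) (Some (of_real (xi D i))) \<longleftrightarrow> cond_C1 D \<phi> i \<or> cond_C2 D \<phi> i)
     \<and> ((\<exists>t. inv_m1 w (node D i) t \<and> - t < - inverse (xi D i)) \<longleftrightarrow> cond_C3 D \<phi> i)
     \<and> ((\<exists>t. inv_m1 w (node D i) t \<and> - inverse (xi D i) < - t) \<longleftrightarrow> cond_C4 D \<phi> i)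
     \<and> (ntlim_m1 w (node D i) (Some 0) \<longleftrightarrow> cond_C5 D \<phi> i \<or> cond_C6 D \<phi> i)"
proof -
  interpret singular_node D i
    using assms by unfold_locales
  show ?thesis
    using boundary_classification[OF assms(3,4)] by blast
qed

end
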